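(* Let $k\ge3$ and $\psi:\mathbb{N}\to[0,1)$. Let $(f_n)_{n=1}^\infty$ be the admissible function system associated to an admissible set system $(A_n)_{n=1}^\infty$ with parameter $\tau$ (see context), and let $C>0$ be the constant from the following estimate: for all $n,n'\in\mathbb{N}$ and all $\boldsymbol\gamma\in\mathbb{R}^k$, $\lambda(f_nf_{n'}(\cdot+\boldsymbol\gamma))\le C\lambda(f_n)\lambda(f_{n'})+O\bigl(\min\{\lambda(f_n)n^{-k},\lambda(f_{n'})(n')^{-k}\}\gcd(n,n')^k(1+\frac{n^{\tau-1-1/k}+(n')^{\tau-1-1/k}}{\gcd(n,n')/(nn')})^{k-1}\bigr)$ (such a constant $C=C_k$ exists). If $\boldsymbol\gamma_{n,n'}\in\mathbb{R}^k$ for $n,n'\in\mathbb{N}$, then \[ \sum_{n,n'\le N}\lambda(f_nf_{n'}(\cdot+\boldsymbol\gamma_{n,n'}))\le C\Bigl(\sum_{n\le N}\lambda(f_n)\Bigr)^2+O\Bigl(\sum_{n\le N}\lambda(f_n)\Bigr). \]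
   Context: $\lambda(f)=\int_{[0,1]^k}f(\mathbf{x})\,d\mathbf{x}$; $\|\cdot\|$ is the distance to the nearest integer. Admissible systems: fix $\tau\in(0,1/k)$ and $\mathbf{y}\in\mathbb{R}^k$. For $m\in\mathbb{N}$ let $D_m=[2^{m-1},2^m)$. For each $m$ choose a finite index set $I_m$ and, for $i\in I_m$, $1\le j\le k$, numbers $d_{i,j}=d_{i,j,m}>0$ with $d_{i,j}\le1/(2n)$ and $n^{-(1+1/k+\tau)}\ll d_{i,j}\ll n^{-(1+1/k-\tau)}$ for all $n\in D_m$, such that $\prod_jd_{i,j}$ does not depend on $i$. To each $(i,j)$ associate $\mathcal{U}_{i,j}$ equal to $[0,nd_{i,j})$ ("first type") or $[nd_{i,j}/2,nd_{i,j})$ ("second type"). For $n\in D_m$ let $A_n=\bigcup_{i\in I_m}\{\mathbf{x}\in[0,1]^k:\|nx_j-y_j\|\in\mathcal{U}_{i,j}\ \forall j\}$, required to be a disjoint union and to satisfy Property $\mathcal{P}_n(\mathbf{y})$: modulo $\mathbb{Z}^k$, $A_n=\mathcal{Z}+n^{-1}(\mathbf{y}+\mathbb{Z}^k)$ for a strongly star-shaped $\mathcal{Z}\subseteq[-1/2,1/2]^k$ ($\mathbf{x}\in\mathcal{Z}$, $|z_j|\le|x_j|\ \forall j\Rightarrow\mathbf{z}\in\mathcal{Z}$). With non-zero smooth bump functions $\omega_1,\omega_2:\mathbb{R}\to[0,1]$ supported on $\{|x|<1\}$ and $\{1/2\le|x|<1\}$ respectively, put $b_{i,j}=\omega_1$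 for first type and $\omega_2$ for second type, and $f_n(\mathbf{x})=\sum_{i\in I_m}\sum_{\mathbf{a}\in\mathbb{Z}^k}\prod_jb_{i,j}\bigl((x_j-(a_j+y_j)/n)/d_{i,j}\bigr)$ for $n\in D_m$. *)

theory Defs
  imports "HOL-Analysis.Analysis"
begin

text \<open>Throughout, the dimension k is CARD('k), and indices n (and m) range over positive integers.\<close>

definition unit_cube :: "(real ^ 'k) set" where
  "unit_cube = {x. \<forall>j. 0 \<le> x $ j \<and> x $ j \<le> 1}"

definition lam :: "(real ^ 'k \<Rightarrow> real) \<Rightarrow> real" where
  "lam f = (LINT x:unit_cube|lborel. f x)"

definition int_lattice :: "(real ^ 'k) set" where
  "int_lattice = {x. \<forall>j. x $ j \<in> \<int>}"

definition mod_lattice :: "(real ^ 'k) set \<Rightarrow> (real ^ 'k) set" where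
  "mod_lattice S = {s + z |s z. s \<in> S \<and> z \<in> int_lattice}"

definition strongly_star_shaped :: "(real ^ 'k) set \<Rightarrow> bool" where
  "strongly_star_shaped Z \<longleftrightarrow>
     (\<forall>x\<in>Z. \<forall>z. (\<forall>j. \<bar>z $ j\<bar> \<le> \<bar>x $ j\<bar>) \<longrightarrow> z \<in> Z)"

text \<open>Equality modulo the integer lattice is equality of the saturations by it.\<close>

definition property_P :: "nat \<Rightarrow> real ^ 'k \<Rightarrow> (real ^ 'k) set \<Rightarrow> bool" where
  "property_P n y A \<longleftrightarrow>
     (\<exists>Z. strongly_star_shaped Z \<and>
          (\<forall>z\<in>Z. \<forall>j. - (1 / 2) \<le> z $ j \<and> z $ j \<le> 1 / 2) \<and>
          mod_lattice A =
            mod_lattice {z + (1 / real n) *\<^sub>R (y + a) |z a. z \<in> Z \<and> a \<in> int_lattice})"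

definition dyadic :: "nat \<Rightarrow> nat set" where
  "dyadic m = {2 ^ (m - 1)..<2 ^ m}"

datatype itype = First_Type | Second_Type

fun type_interval :: "itype \<Rightarrow> real \<Rightarrow> real set" where
  "type_interval First_Type r = {0..<r}"
| "type_interval Second_Type r = {r / 2..<r}"

definition piece ::
  "real ^ 'k \<Rightarrow> nat \<Rightarrow> ('k \<Rightarrow> real) \<Rightarrow> ('k \<Rightarrow> itype) \<Rightarrow> (real ^ 'k) set" where
  "piece y n \<delta> t =
     {x \<in> unit_cube. \<forall>j. infdist (real n * x $ j - y $ j) \<int> \<in> type_interval (t j) (real n * \<delta> j)}"

text \<open>Here \<open>d m i j\<close> and \<open>ty m i j\<close> are the side length and the type attached to the pair
  (i, j) at level m; they are only constrained for \<open>i \<in> I m\<close> and \<open>m \<ge> 1\<close>. The implied constants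
  in the size bounds for \<open>d\<close> are uniform in m, n, i and j.\<close>

locale admissible_set_system =
  fixes \<tau> :: real
    and y :: "real ^ 'k"
    and I :: "nat \<Rightarrow> 'i set"
    and d :: "nat \<Rightarrow> 'i \<Rightarrow> 'k \<Rightarrow> real"
    and ty :: "nat \<Rightarrow> 'i \<Rightarrow> 'k \<Rightarrow> itype"
    and A :: "nat \<Rightarrow> (real ^ 'k) set"
  assumes tau: "0 < \<tau>" "\<tau> < 1 / real CARD('k)"
    and finite_index: "\<And>m. m \<ge> 1 \<Longrightarrow> finite (I m)"
    and d_pos: "\<And>m i j. m \<ge> 1 \<Longrightarrow> i \<in> I m \<Longrightarrow> d m i j > 0"
    and d_le: "\<And>m n i j. m \<ge> 1 \<Longrightarrow> n \<in> dyadic m \<Longrightarrow> i \<in> I m \<Longrightarrow> d m i j \<le> 1 / (2 * real n)"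
    and d_lower: "\<exists>c>0. \<forall>m\<ge>1. \<forall>n\<in>dyadic m. \<forall>i\<in>I m. \<forall>j.
          c * real n powr (- (1 + 1 / real CARD('k) + \<tau>)) \<le> d m i j"
    and d_upper: "\<exists>c>0. \<forall>m\<ge>1. \<forall>n\<in>dyadic m. \<forall>i\<in>I m. \<forall>j.
          d m i j \<le> c * real n powr (- (1 + 1 / real CARD('k) - \<tau>))"
    and prod_d: "\<And>m i i'. m \<ge> 1 \<Longrightarrow> i \<in> I m \<Longrightarrow> i' \<in> I m \<Longrightarrow>
          (\<Prod>j\<in>UNIV. d m i j) = (\<Prod>j\<in>UNIV. d m i' j)"
    and A_eq: "\<And>m n. m \<ge> 1 \<Longrightarrow> n \<in> dyadic m \<Longrightarrow> A n = (\<Union>i\<in>I m. piece y n (d m i) (ty m i))"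
    and disjoint: "\<And>m n. m \<ge> 1 \<Longrightarrow> n \<in> dyadic m \<Longrightarrow>
          disjoint_family_on (\<lambda>i. piece y n (d m i) (ty m i)) (I m)"
    and prop_P: "\<And>n. n \<ge> 1 \<Longrightarrow> property_P n y (A n)"

text \<open>``Supported on S'' means vanishing outside S, since the prescribed sets are not closed.\<close>

definition bump_on :: "real set \<Rightarrow> (real \<Rightarrow> real) \<Rightarrow> bool" where
  "bump_on S \<omega> \<longleftrightarrow>
     (\<forall>p x. (deriv ^^ p) \<omega> field_differentiable (at x)) \<and>
     (\<forall>x. 0 \<le> \<omega> x \<and> \<omega> x \<le> 1) \<and>
     (\<exists>x. \<omega> x \<noteq> 0) \<and>
     (\<forall>x. x \<notin> S \<longrightarrow> \<omega> x = 0)"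

fun type_bump :: "(real \<Rightarrow> real) \<Rightarrow> (real \<Rightarrow> real) \<Rightarrow> itype \<Rightarrow> real \<Rightarrow> real" where
  "type_bump \<omega>1 \<omega>2 First_Type = \<omega>1"
| "type_bump \<omega>1 \<omega>2 Second_Type = \<omega>2"

definition associated_function_system ::
  "(real \<Rightarrow> real) \<Rightarrow> (real \<Rightarrow> real) \<Rightarrow> real ^ 'k \<Rightarrow> (nat \<Rightarrow> 'i set) \<Rightarrow> (nat \<Rightarrow> 'i \<Rightarrow> 'k \<Rightarrow> real)
   \<Rightarrow> (nat \<Rightarrow> 'i \<Rightarrow> 'k \<Rightarrow> itype) \<Rightarrow> (nat \<Rightarrow> real ^ 'k \<Rightarrow> real) \<Rightarrow> bool" where
  "associated_function_system \<omega>1 \<omega>2 y I d ty f \<longleftrightarrow>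
     bump_on {x. \<bar>x\<bar> < 1} \<omega>1 \<and> bump_on {x. 1 / 2 \<le> \<bar>x\<bar> \<and> \<bar>x\<bar> < 1} \<omega>2 \<and>
     (\<forall>m\<ge>1. \<forall>n\<in>dyadic m. \<forall>x.
        f n x = (\<Sum>i\<in>I m. \<Sum>\<^sub>\<infinity>a\<in>(UNIV :: (int ^ 'k) set). \<Prod>j\<in>UNIV.
          type_bump \<omega>1 \<omega>2 (ty m i j) ((x $ j - (of_int (a $ j) + y $ j) / real n) / d m i j)))"

definition overlap :: "(nat \<Rightarrow> real ^ 'k \<Rightarrow> real) \<Rightarrow> nat \<Rightarrow> nat \<Rightarrow> real ^ 'k \<Rightarrow> real" where
  "overlap f n n' \<gamma> = lam (\<lambda>x. f n x * f n' (x + \<gamma>))"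

definition overlap_error :: "real \<Rightarrow> (nat \<Rightarrow> real ^ 'k \<Rightarrow> real) \<Rightarrow> nat \<Rightarrow> nat \<Rightarrow> real" where
  "overlap_error \<tau> f n n' =
     min (lam (f n) / real n ^ CARD('k)) (lam (f n') / real n' ^ CARD('k))
     * real (gcd n n') ^ CARD('k)
     * (1 + (real n powr (\<tau> - 1 - 1 / real CARD('k)) + real n' powr (\<tau> - 1 - 1 / real CARD('k)))
            / (real (gcd n n') / (real n * real n'))) ^ (CARD('k) - 1)"

definition overlap_estimate :: "real \<Rightarrow> (nat \<Rightarrow> real ^ 'k \<Rightarrow> real) \<Rightarrow> real \<Rightarrow> bool" where
  "overlap_estimate \<tau> f C \<longleftrightarrow>
     (\<exists>K. \<forall>n\<ge>1. \<forall>n'\<ge>1. \<forall>\<gamma>.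
        overlap f n n' \<gamma> \<le> C * lam (f n) * lam (f n') + K * overlap_error \<tau> f n n')"

end

theory Submission
  imports Defs "HOL-Computational_Algebra.Primes"
begin

text \<open>Each pair is charged to its larger member: for \<open>n' \<le> n\<close> the error term is at most
  \<open>\<lambda>(f\<^sub>n) n\<^sup>-\<^sup>k\<close> times a constant multiple of \<open>g\<^sup>k + n\<^sup>k\<^sup>-\<^sup>1 g n'\<^sup>-\<^sup>\<epsilon>\<close>, where \<open>g = gcd(n,n')\<close> and
  \<open>\<epsilon> = (k-1)(1/k-\<tau>)\<close>. Grouping \<open>n'\<close> by \<open>g\<close>, the first summand contributes
  \<open>n\<^sup>k\<close> times a partial sum of \<open>\<Sum> e\<^sup>1\<^sup>-\<^sup>k\<close>, and the second \<open>n\<^sup>k\<^sup>-\<^sup>\<epsilon>\<close> times the number of divisors of \<open>n\<close>,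
  so that the divisor bound gives \<open>O(n\<^sup>k)\<close> in total.\<close>

section \<open>The divisor bound\<close>

text \<open>Every divisor splits as \<open>p ^ b * e\<close> with \<open>b \<le> a\<close> and
  \<open>e dvd m\<close>, so the \<open>Suc a * card {d. d dvd m}\<close> such pairs map onto the
  divisors.\<close>

lemma card_divisors_mult_prime_power_le:
  fixes p m a :: nat
  assumes "prime p" "m > 0"
  shows "card {d. d dvd p ^ a * m} \<le> Suc a * card {d. d dvd m}"
proof -
  have "{d. d dvd p ^ a * m} \<subseteq> (\<lambda>(b, e). p ^ b * e) ` ({..a} \<times> {d. d dvd m})"
  proof
    fix d assume "d \<in> {d. d dvd p ^ a * m}"
    then obtain u v where uv: "d = u * v" "u dvd p ^ a" "v dvd m"
      using division_decomp[of d "p ^ a" m] by auto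
    then obtain b where "b \<le> a" "u = p ^ b"
      using divides_primepow_nat[OF assms(1)] by auto
    with uv show "d \<in> (\<lambda>(b, e). p ^ b * e) ` ({..a} \<times> {d. d dvd m})"
      by (auto intro!: image_eqI[of _ _ "(b, v)"])
  qed
  moreover have fin: "finite ({..a} \<times> {d. d dvd m})"
    using assms by auto
  ultimately have "card {d. d dvd p ^ a * m} \<le> card ({..a} \<times> {d. d dvd m})"
    by (rule surj_card_le[rotated])
  then show ?thesis by (simp add: card_cartesian_product)
qed

text \<open>Induction removing the full power \<open>p ^ a\<close> of one prime: the divisor count
  grows by at most \<open>a + 1\<close>, while \<open>n powr \<epsilon>\<close> grows by
  \<open>(p powr \<epsilon>) ^ a\<close>. Primes from \<open>P\<close> on cost nothing, since
  \<open>a + 1 \<le> 2 ^ a\<close>. Each smaller prime costs one factor \<open>B\<close>, which is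
  why the exponent of \<open>B\<close> counts only small primes.\<close>

lemma card_divisors_le_small_primes:
  fixes \<epsilon> B :: real and P :: nat
  assumes "\<epsilon> > 0" and B: "B \<ge> 1" "B \<ge> 1 / (\<epsilon> * ln 2)"
    and P: "\<And>p. p \<ge> P \<Longrightarrow> real p powr \<epsilon> \<ge> 2"
    and "n > 0"
  shows "real (card {d. d dvd n}) \<le> B ^ card {p \<in> prime_factors n. p < P} * real n powr \<epsilon>"
  using \<open>n > 0\<close>
proof (induction n rule: less_induct)
  case (less n)
  show ?case
  proof (cases "n = 1")
    case True
    then show ?thesis by simp
  next
    case False
    then obtain p where p: "prime p" "p dvd n"
      using prime_factor_nat by blast
    define a where "a = multiplicity p n"
    obtain m where m: "n = p ^ a * m" "\<not> p dvd m"
      using multiplicity_decompose'[of n p] p less.prems not_prime_unit[of p]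
      unfolding a_def by (metis gr_implies_not0)
    have a: "a > 0"
      unfolding a_def using p less.prems by (simp add: prime_multiplicity_gt_zero_iff)
    have "m > 0" using m less.prems by (auto intro: Nat.gr0I)
    have p2: "p \<ge> 2" using p prime_ge_2_nat by blast
    have "m < n"
    proof -
      have "p ^ a > 1" using p2 a by (intro one_less_power) auto
      then show ?thesis using m \<open>m > 0\<close> by simp
    qed
    note IH = less.IH[OF this \<open>m > 0\<close>]
    have factors: "prime_factors n = insert p (prime_factors m)"
      using m p a \<open>m > 0\<close> p2
      by (simp add: prime_factors_product prime_factorization_prime_power)
    have "p \<notin> prime_factors m" using m by auto
    let ?c = "card {q \<in> prime_factors m. q < P}"
    let ?c' = "card {q \<in> prime_factors n. q < P}"
    have powr_n: "real n powr \<epsilon> = (real p powr \<epsilon>) ^ a * real m powr \<epsilon>"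
      using m p2 \<open>m > 0\<close>
      by (simp add: powr_mult powr_powr powr_realpow[symmetric] mult.commute)
    have step: "real (Suc a) * B ^ ?c \<le> B ^ ?c' * (real p powr \<epsilon>) ^ a"
    proof (cases "p < P")
      case True
      have "{q \<in> prime_factors n. q < P} = insert p {q \<in> prime_factors m. q < P}"
        using True factors by auto
      then have c': "?c' = Suc ?c"
        using \<open>p \<notin> prime_factors m\<close> by (simp add: card_insert_if)
      \<comment> \<open>For a small prime, growth linear in \<open>a\<close> is all that is
        available; its slope \<open>\<epsilon> * ln 2\<close> is what the lower bound on
        \<open>B\<close> compensates.\<close>
      have "1 + real a * (\<epsilon> * ln 2) \<le> exp (real a * (\<epsilon> * ln 2))"
        by (rule exp_ge_add_one_self)
      also have "\<dots> = (2 powr \<epsilon>) ^ a"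
        by (simp add: powr_def exp_of_nat_mult)
      also have "\<dots> \<le> (real p powr \<epsilon>) ^ a"
        using p2 assms by (intro power_mono powr_mono2) auto
      finally have *: "1 + real a * (\<epsilon> * ln 2) \<le> (real p powr \<epsilon>) ^ a" .
      have "1 \<le> B * (\<epsilon> * ln 2)"
        using B(2) assms(1) by (simp add: divide_le_eq)
      then have "real (Suc a) \<le> B * (1 + real a * (\<epsilon> * ln 2))"
        using B(1) mult_left_mono[of 1 "B * (\<epsilon> * ln 2)" "real a"]
        by (simp add: algebra_simps)
      also have "\<dots> \<le> B * (real p powr \<epsilon>) ^ a"
        using * B by (intro mult_left_mono) auto
      finally have "real (Suc a) * B ^ ?c \<le> (B * (real p powr \<epsilon>) ^ a) * B ^ ?c"
        using B by (intro mult_right_mono) auto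
      then show ?thesis by (simp add: c' mult_ac)
    next
      case False
      have "{q \<in> prime_factors n. q < P} = {q \<in> prime_factors m. q < P}"
        using False factors by auto
      moreover have "real (Suc a) \<le> (real p powr \<epsilon>) ^ a"
      proof -
        have "Suc a \<le> 2 ^ a" using less_exp[of a] by linarith
        then have "real (Suc a) \<le> 2 ^ a"
          by (metis of_nat_le_iff of_nat_numeral of_nat_power)
        also have "\<dots> \<le> (real p powr \<epsilon>) ^ a"
          using P False by (intro power_mono) auto
        finally show ?thesis .
      qed
      ultimately show ?thesis
        using B mult_right_mono[of "real (Suc a)" "(real p powr \<epsilon>) ^ a" "B ^ ?c"]
        by (simp add: mult_ac)
    qed
    have "real (card {d. d dvd n}) \<le> real (Suc a * card {d. d dvd m})"
      unfolding m(1) using card_divisors_mult_prime_power_le[OF p(1) \<open>m > 0\<close>] of_nat_le_iff by blast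
    also have "\<dots> \<le> real (Suc a) * (B ^ ?c * real m powr \<epsilon>)"
      unfolding of_nat_mult using IH by (intro mult_left_mono) auto
    also have "\<dots> \<le> (B ^ ?c' * (real p powr \<epsilon>) ^ a) * real m powr \<epsilon>"
      using mult_right_mono[OF step, of "real m powr \<epsilon>"] by (simp only: mult_ac powr_ge_zero)
    finally show ?thesis by (simp only: powr_n mult_ac)
  qed
qed

text \<open>There are at most \<open>P\<close> small primes, so the power of \<open>B\<close> in the
  previous estimate is bounded independently of \<open>n\<close>.\<close>

lemma divisor_bound:
  fixes \<epsilon> :: real
  assumes "\<epsilon> > 0"
  obtains D where "D \<ge> 0" "\<And>n. n > 0 \<Longrightarrow> real (card {d. d dvd n}) \<le> D * real n powr \<epsilon>"
proof -
  define B where "B = max 1 (1 / (\<epsilon> * ln 2))"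
  \<comment> \<open>The threshold past which \<open>p powr \<epsilon> \<ge> 2\<close>.\<close>
  define P where "P = nat \<lceil>2 powr (1 / \<epsilon>)\<rceil>"
  have P: "real p powr \<epsilon> \<ge> 2" if "p \<ge> P" for p
  proof -
    have "2 powr (1 / \<epsilon>) \<le> real p"
      using that unfolding P_def by linarith
    then have "(2 powr (1 / \<epsilon>)) powr \<epsilon> \<le> real p powr \<epsilon>"
      using assms by (intro powr_mono2) auto
    then show ?thesis using assms by (simp add: powr_powr)
  qed
  have "real (card {d. d dvd n}) \<le> B ^ P * real n powr \<epsilon>" if "n > 0" for n
  proof -
    have "card {p \<in> prime_factors n. p < P} \<le> card {..<P}"
      by (intro card_mono) auto
    then have "B ^ card {p \<in> prime_factors n. p < P} \<le> B ^ P"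
      by (intro power_increasing) (auto simp: B_def)
    moreover have "real (card {d. d dvd n})
        \<le> B ^ card {p \<in> prime_factors n. p < P} * real n powr \<epsilon>"
      using assms P that
      by (intro card_divisors_le_small_primes) (auto simp: B_def)
    ultimately show ?thesis
      by (meson mult_right_mono order_trans powr_ge_zero)
  qed
  moreover have "B ^ P \<ge> 0" by (simp add: B_def)
  ultimately show ?thesis using that by blast
qed

section \<open>Sums over greatest common divisors\<close>

text \<open>The map from \<open>m\<close> to \<open>(d, l)\<close> with \<open>d = gcd n m\<close>
  and \<open>m = d * l\<close> is injective. Its image satisfies \<open>d dvd n\<close> and
  \<open>l \<le> n div d\<close>; dropping the coprimality of \<open>l\<close> and
  \<open>n div d\<close> only adds nonnegative terms.\<close>

lemma sum_gcd_le_sum_divisors: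
  fixes h w :: "nat \<Rightarrow> real"
  assumes "n > 0" and "\<And>d. h d \<ge> 0" and "\<And>m. w m \<ge> 0"
  shows "(\<Sum>m=1..n. h (gcd n m) * w m)
    \<le> (\<Sum>d | d dvd n. h d * (\<Sum>l=1..n div d. w (d * l)))"
proof -
  define S where "S = (SIGMA d:{d. d dvd n}. {1..n div d})"
  define r where "r = (\<lambda>m. (gcd n m, m div gcd n m))"
  have "inj_on r {1..n}"
    by (rule inj_on_inverseI[where g = "\<lambda>(d, l). d * l"]) (auto simp: r_def)
  then have "(\<Sum>m=1..n. h (gcd n m) * w m) = (\<Sum>(d, l)\<in>r ` {1..n}. h d * w (d * l))"
    by (subst sum.reindex) (auto simp: r_def intro!: sum.cong)
  also have "\<dots> \<le> (\<Sum>(d, l)\<in>S. h d * w (d * l))"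
  proof (intro sum_mono2)
    show "finite S" unfolding S_def using assms by auto
    show "r ` {1..n} \<subseteq> S"
      using assms(1)
      by (auto simp: S_def r_def div_le_mono Suc_le_eq div_greater_zero_iff
          intro!: gcd_le2_nat)
  qed (use assms in auto)
  also have "\<dots> = (\<Sum>d | d dvd n. \<Sum>l=1..n div d. h d * w (d * l))"
    unfolding S_def using assms by (subst sum.Sigma) auto
  finally show ?thesis by (simp add: sum_distrib_left)
qed

section \<open>Power sums of divisors and of gcds\<close>

lemma sum_inverse_squares_le: "(\<Sum>e=1..n. 1 / real e ^ 2) \<le> 2 - 1 / real n"
proof (induction n)
  case (Suc n)
  show ?case
  \<comment> \<open>Since \<open>1 / real 0\<close> is \<open>0\<close>, the telescoping below
    starts only at \<open>n = 1\<close>.\<close>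
  proof (cases "n = 0")
    case False
    \<comment> \<open>The new term is at most \<open>1/n - 1/(n+1)\<close>, exactly the change in
      the claimed bound.\<close>
    then have "1 / real (Suc n) ^ 2 \<le> 1 / (real n * real (Suc n))"
      by (intro divide_left_mono) (auto simp: power2_eq_square)
    also have "\<dots> = 1 / real n - 1 / real (Suc n)"
      using False by (simp add: field_simps)
    finally show ?thesis using Suc by simp
  qed simp
qed simp

text \<open>The involution sending \<open>d\<close> to \<open>n div d\<close> turns the sum into
  \<open>n ^ q\<close> times a sum of \<open>1 / e ^ q\<close>, and \<open>q \<ge> 2\<close> allows
  comparison with inverse squares.\<close>

lemma sum_divisors_power_le:
  assumes "n > 0" "q \<ge> 2"
  shows "(\<Sum>d | d dvd n. real d ^ q) \<le> 2 * real n ^ q"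
proof -
  have "(\<Sum>d | d dvd n. real d ^ q) = (\<Sum>e | e dvd n. real (n div e) ^ q)"
    using assms
    by (intro sum.reindex_bij_witness[where i = "\<lambda>e. n div e" and j = "\<lambda>e. n div e"])
      (auto elim!: dvdE)
  also have "\<dots> \<le> (\<Sum>e | e dvd n. real n ^ q * (1 / real e ^ 2))"
  proof (intro sum_mono)
    fix e assume "e \<in> {e. e dvd n}"
    then have e: "e dvd n" "e > 0" using assms by (auto intro: Nat.gr0I)
    have "real (n div e) ^ q = real n ^ q * (1 / real e ^ q)"
      using e by (simp add: real_of_nat_div power_divide)
    also have "\<dots> \<le> real n ^ q * (1 / real e ^ 2)"
      using e assms by (intro mult_left_mono divide_left_mono power_increasing) auto
    finally show "real (n div e) ^ q \<le> real n ^ q * (1 / real e ^ 2)" .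
  qed
  also have "\<dots> \<le> (\<Sum>e=1..n. real n ^ q * (1 / real e ^ 2))"
    using assms by (intro sum_mono2) (auto intro: dvd_imp_le Nat.gr0I simp: Suc_le_eq)
  also have "\<dots> = real n ^ q * (\<Sum>e=1..n. 1 / real e ^ 2)"
    by (simp add: sum_distrib_left)
  also have "\<dots> \<le> real n ^ q * 2"
    using order_trans[OF sum_inverse_squares_le[of n], of 2] by (intro mult_left_mono) auto
  finally show ?thesis by simp
qed

text \<open>A divisor \<open>d\<close> is the gcd for at most \<open>n div d\<close> values of
  \<open>m\<close>, which lowers the exponent to \<open>k - 1\<close>. For \<open>k \<ge> 3\<close>
  this is still at least 2, as the divisor power sum requires.\<close>

lemma sum_gcd_power_le:
  assumes "n > 0" "k \<ge> 3"
  shows "(\<Sum>m=1..n. real (gcd n m) ^ k) \<le> 2 * real n ^ k"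
proof -
  have "(\<Sum>m=1..n. real (gcd n m) ^ k) \<le> (\<Sum>d | d dvd n. real d ^ k * real (n div d))"
    using sum_gcd_le_sum_divisors[of n "\<lambda>d. real d ^ k" "\<lambda>_. 1"] assms by simp
  also have "\<dots> = (\<Sum>d | d dvd n. real n * real d ^ (k - 1))"
    using assms
    by (intro sum.cong) (auto simp: real_of_nat_div power_eq_if[of _ k])
  also have "\<dots> = real n * (\<Sum>d | d dvd n. real d ^ (k - 1))"
    by (simp add: sum_distrib_left)
  also have "\<dots> \<le> real n * (2 * real n ^ (k - 1))"
    using assms by (intro mult_left_mono sum_divisors_power_le) auto
  also have "\<dots> = 2 * real n ^ k"
    using assms by (simp add: power_eq_if[of _ k])
  finally show ?thesis .
qed

section \<open>Gcd sums with a decaying weight\<close>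

lemma sum_powr_le:
  fixes \<epsilon> :: real
  assumes "0 < \<epsilon>" "\<epsilon> < 1"
  shows "(\<Sum>l=1..M. real l powr (- \<epsilon>)) \<le> real M powr (1 - \<epsilon>) / (1 - \<epsilon>)"
proof (induction M)
  case (Suc M)
  let ?x = "real (Suc M)"
  show ?case
  proof (cases "M = 0")
    case True
    then show ?thesis using assms by simp
  next
    case False
  \<comment> \<open>Weighted AM-GM for \<open>M / (M + 1)\<close> and \<open>1\<close> replaces
    comparison with the integral of \<open>t powr (- \<epsilon>)\<close>: it bounds the new summand
    by the increment of \<open>M powr (1 - \<epsilon>) / (1 - \<epsilon>)\<close>.\<close>
  have "(real M / ?x) powr (1 - \<epsilon>) * 1 powr \<epsilon> \<le> (1 - \<epsilon>) * (real M / ?x) + \<epsilon> * 1"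
    using assms False by (intro Youngs_inequality_0) auto
  then have "real M powr (1 - \<epsilon>) / ?x powr (1 - \<epsilon>) \<le> 1 - (1 - \<epsilon>) / ?x"
    by (simp add: powr_divide field_simps)
  then have "real M powr (1 - \<epsilon>) \<le> ?x powr (1 - \<epsilon>) - (1 - \<epsilon>) * (?x powr (1 - \<epsilon>) / ?x)"
    by (simp add: field_simps)
  moreover have "?x powr (1 - \<epsilon>) / ?x = ?x powr (- \<epsilon>)"
    by (simp add: powr_diff powr_minus_divide)
  ultimately have "real M powr (1 - \<epsilon>) + (1 - \<epsilon>) * ?x powr (- \<epsilon>) \<le> ?x powr (1 - \<epsilon>)"
    by (simp only: le_diff_eq)
  from divide_right_mono[OF this, of "1 - \<epsilon>"]
  have "real M powr (1 - \<epsilon>) / (1 - \<epsilon>) + ?x powr (- \<epsilon>) \<le> ?x powr (1 - \<epsilon>) / (1 - \<epsilon>)"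
    using assms by (simp add: add_divide_distrib)
  then show ?thesis using Suc by simp
  qed
qed simp

text \<open>After grouping by the gcd, every divisor \<open>d\<close> contributes at most the same
  amount, \<open>n powr (1 - \<epsilon>) / (1 - \<epsilon>)\<close>. The divisor bound with the same
  exponent \<open>\<epsilon>\<close> then restores a full power of \<open>n\<close>.\<close>

lemma sum_gcd_powr_le:
  fixes \<epsilon> :: real
  assumes "0 < \<epsilon>" "\<epsilon> < 1"
  obtains D where "D \<ge> 0"
    "\<And>n. n > 0 \<Longrightarrow> (\<Sum>m=1..n. real (gcd n m) * real m powr (- \<epsilon>)) \<le> D * real n"
proof -
  obtain D where D: "D \<ge> 0" "\<And>n. n > 0 \<Longrightarrow> real (card {d. d dvd n}) \<le> D * real n powr \<epsilon>"
    using divisor_bound[OF assms(1)] by blast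
  have "(\<Sum>m=1..n. real (gcd n m) * real m powr (- \<epsilon>)) \<le> D / (1 - \<epsilon>) * real n"
    if n: "n > 0" for n
  proof -
    have "(\<Sum>m=1..n. real (gcd n m) * real m powr (- \<epsilon>))
        \<le> (\<Sum>d | d dvd n. real d * (\<Sum>l=1..n div d. real (d * l) powr (- \<epsilon>)))"
      using n by (intro sum_gcd_le_sum_divisors) auto
    also have "\<dots> \<le> (\<Sum>d | d dvd n. real n powr (1 - \<epsilon>) / (1 - \<epsilon>))"
    proof (intro sum_mono)
      fix d assume "d \<in> {d. d dvd n}"
      then have d: "d dvd n" "d > 0" using n by (auto intro: Nat.gr0I)
      have "real d * (\<Sum>l=1..n div d. real (d * l) powr (- \<epsilon>))
          = real d * real d powr (- \<epsilon>) * (\<Sum>l=1..n div d. real l powr (- \<epsilon>))"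
        by (simp add: powr_mult sum_distrib_left mult_ac)
      also have "\<dots> \<le> real d * real d powr (- \<epsilon>) * (real (n div d) powr (1 - \<epsilon>) / (1 - \<epsilon>))"
        using assms by (intro mult_left_mono sum_powr_le) auto
      also have "real d * real d powr (- \<epsilon>) = real d powr (1 - \<epsilon>)"
        using d by (simp add: powr_diff powr_minus field_simps)
      also have "real d powr (1 - \<epsilon>) * (real (n div d) powr (1 - \<epsilon>) / (1 - \<epsilon>))
          = real n powr (1 - \<epsilon>) / (1 - \<epsilon>)"
        using d by (simp add: powr_mult[symmetric] real_of_nat_div)
      finally show "real d * (\<Sum>l=1..n div d. real (d * l) powr (- \<epsilon>))
          \<le> real n powr (1 - \<epsilon>) / (1 - \<epsilon>)" .
    qed
    also have "\<dots> = real (card {d. d dvd n}) * (real n powr (1 - \<epsilon>) / (1 - \<epsilon>))"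
      by simp
    also have "\<dots> \<le> D * real n powr \<epsilon> * (real n powr (1 - \<epsilon>) / (1 - \<epsilon>))"
      using D n assms by (intro mult_right_mono) auto
    also have "\<dots> = D / (1 - \<epsilon>) * (real n powr \<epsilon> * real n powr (1 - \<epsilon>))"
      by simp
    also have "real n powr \<epsilon> * real n powr (1 - \<epsilon>) = real n"
      using n by (simp add: powr_add[symmetric])
    finally show ?thesis .
  qed
  moreover have "D / (1 - \<epsilon>) \<ge> 0" using D assms by simp
  ultimately show ?thesis using that by blast
qed

section \<open>Summing the overlap errors\<close>

lemma overlap_error_commute: "overlap_error \<tau> f n m = overlap_error \<tau> f m n"
  by (simp add: overlap_error_def min.commute gcd.commute add.commute mult.commute)

lemma overlap_error_nonneg:
  assumes "lam (f n) \<ge> 0" "lam (f m) \<ge> 0"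
  shows "overlap_error \<tau> f n m \<ge> 0"
  unfolding overlap_error_def using assms
  by (intro mult_nonneg_nonneg zero_le_power add_nonneg_nonneg divide_nonneg_nonneg) auto

text \<open>Bounding \<open>1 + x\<close> by \<open>2 * max 1 x\<close> separates the two regimes of
  the error term at the cost of a constant.\<close>

lemma one_plus_power_le:
  fixes x :: real
  assumes "x \<ge> 0"
  shows "(1 + x) ^ q \<le> 2 ^ q * (1 + x ^ q)"
proof -
  have "(1 + x) ^ q \<le> (2 * max 1 x) ^ q"
    using assms by (intro power_mono) auto
  also have "\<dots> = 2 ^ q * max 1 x ^ q" by (simp add: power_mult_distrib)
  also have "max 1 x ^ q \<le> 1 + x ^ q"
    using assms by (cases "x \<le> 1") (auto simp: max_def)
  finally show ?thesis by simp
qed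

text \<open>The exponent \<open>\<epsilon>\<close> arises from raising
  \<open>m powr (\<tau> - 1 / k)\<close> to the power \<open>k - 1\<close>. The bound involves
  \<open>lam\<close> only at the larger index \<open>n\<close>, so it can be summed over
  \<open>m \<le> n\<close>.\<close>

lemma overlap_error_le:
  fixes f :: "nat \<Rightarrow> real ^ 'k \<Rightarrow> real" and \<tau> :: real
  defines "k \<equiv> CARD('k)"
  defines "\<epsilon> \<equiv> (1 / real k - \<tau>) * real (k - 1)"
  assumes \<tau>: "\<tau> < 1 / real k" and mn: "0 < m" "m \<le> n" and "lam (f n) \<ge> 0"
  shows "overlap_error \<tau> f n m \<le> lam (f n) / real n ^ k *
    (4 ^ k * (real (gcd n m) ^ k + real n ^ (k - 1) * (real (gcd n m) * real m powr (- \<epsilon>))))"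
proof -
  define g where "g = real (gcd n m)"
  have g: "g > 0" using mn by (simp add: g_def)
  have k: "k > 0" by (simp add: k_def)
  let ?s = "\<tau> - 1 - 1 / real k"
  define X where "X = (real n powr ?s + real m powr ?s) / (g / (real n * real m))"
  have X0: "X \<ge> 0" using g by (simp add: X_def)
  have "X \<le> 2 * real m powr ?s * real n * real m / g"
  proof -
    \<comment> \<open>The exponent is not positive, so the smaller index \<open>m\<close> gives the
      larger power.\<close>
    have "?s \<le> 0" using \<tau> k by (simp add: field_simps)
    then have "real n powr ?s \<le> real m powr ?s"
      using mn by (intro powr_mono2') auto
    then have "(real n powr ?s + real m powr ?s) * (real n * real m / g)
        \<le> (2 * real m powr ?s) * (real n * real m / g)"
      using g by (intro mult_right_mono) auto
    then show ?thesis by (simp add: X_def mult_ac)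
  qed
  \<comment> \<open>The factor \<open>real m\<close> raises the exponent of \<open>m\<close> by
    one.\<close>
  also have "\<dots> = 2 * real n * real m powr (\<tau> - 1 / real k) / g"
    using powr_add[of "real m" ?s 1] mn by (simp add: mult_ac)
  finally have "X ^ (k - 1) \<le> (2 * real n * real m powr (\<tau> - 1 / real k) / g) ^ (k - 1)"
    using X0 by (intro power_mono) auto
  also have "\<dots> = 2 ^ (k - 1) * (real n ^ (k - 1) * real m powr (- \<epsilon>) / g ^ (k - 1))"
    using mn
    by (simp add: power_mult_distrib power_divide powr_power \<epsilon>_def algebra_simps)
  finally have X: "X ^ (k - 1) \<le>
    2 ^ (k - 1) * (real n ^ (k - 1) * real m powr (- \<epsilon>) / g ^ (k - 1))" .
  \<comment> \<open>Against the denominator \<open>g ^ (k - 1)\<close> exactly one factor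
    \<open>g\<close> survives.\<close>
  have gk: "g ^ k = g * g ^ (k - 1)" using k by (simp add: power_eq_if)
  have "g ^ k * (1 + X) ^ (k - 1) \<le> g ^ k * (2 ^ (k - 1) * (1 +
      2 ^ (k - 1) * (real n ^ (k - 1) * real m powr (- \<epsilon>) / g ^ (k - 1))))"
    using order_trans[OF one_plus_power_le[OF X0]] X g
    by (intro mult_left_mono) auto
  also have "\<dots> = 2 ^ (k - 1) * g ^ k +
      4 ^ (k - 1) * (real n ^ (k - 1) * (g * real m powr (- \<epsilon>)))"
  proof -
    have "(4::real) ^ (k - 1) = 2 ^ (k - 1) * 2 ^ (k - 1)"
      by (simp add: power_mult_distrib[symmetric])
    then show ?thesis using g unfolding gk by (simp add: field_simps)
  qed
  also have "\<dots> \<le> 4 ^ k * g ^ k + 4 ^ k * (real n ^ (k - 1) * (g * real m powr (- \<epsilon>)))"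
  proof (intro add_mono mult_right_mono)
    have "(2::real) ^ (k - 1) \<le> 4 ^ (k - 1)" by (intro power_mono) auto
    also have "\<dots> \<le> (4::real) ^ k" by (intro power_increasing) auto
    finally show "(2::real) ^ (k - 1) \<le> 4 ^ k" .
    show "(4::real) ^ (k - 1) \<le> 4 ^ k" by (intro power_increasing) auto
  qed (use g in auto)
  finally have main: "g ^ k * (1 + X) ^ (k - 1) \<le>
    4 ^ k * (g ^ k + real n ^ (k - 1) * (g * real m powr (- \<epsilon>)))"
    by (simp add: distrib_left)
  have "overlap_error \<tau> f n m =
      min (lam (f n) / real n ^ k) (lam (f m) / real m ^ k) * (g ^ k * (1 + X) ^ (k - 1))"
    by (simp add: overlap_error_def g_def X_def k_def)
  also have "\<dots> \<le> lam (f n) / real n ^ k * (g ^ k * (1 + X) ^ (k - 1))"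
    using g X0 by (intro mult_right_mono) auto
  also have "\<dots> \<le> lam (f n) / real n ^ k *
      (4 ^ k * (g ^ k + real n ^ (k - 1) * (g * real m powr (- \<epsilon>))))"
    using main assms by (intro mult_left_mono) auto
  finally show ?thesis by (simp add: g_def)
qed

text \<open>Both gcd sums over \<open>m \<le> n\<close> are \<open>O(n ^ k)\<close>, which cancels
  the normalisation \<open>n ^ k\<close> in the bound for a single error.\<close>

lemma sum_overlap_error_le:
  fixes f :: "nat \<Rightarrow> real ^ 'k \<Rightarrow> real"
  assumes k3: "CARD('k) \<ge> 3" and \<tau>: "0 < \<tau>" "\<tau> < 1 / real CARD('k)"
    and lam: "\<And>n. n > 0 \<Longrightarrow> lam (f n) \<ge> 0"
  obtains D where "D \<ge> 0"
    "\<And>n. n > 0 \<Longrightarrow> (\<Sum>m=1..n. overlap_error \<tau> f n m) \<le> D * lam (f n)"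
proof -
  define k where "k = CARD('k)"
  define \<epsilon> where "\<epsilon> = (1 / real k - \<tau>) * real (k - 1)"
  \<comment> \<open>Here \<open>\<tau> < 1 / k\<close> gives positivity, and
    \<open>\<tau> > 0\<close> gives \<open>\<epsilon> \<le> (k - 1) / k < 1\<close>.\<close>
  have \<epsilon>: "0 < \<epsilon>" "\<epsilon> < 1"
  proof -
    show "0 < \<epsilon>" using k3 \<tau> by (simp add: \<epsilon>_def k_def)
    have "\<epsilon> \<le> 1 / real k * real (k - 1)"
      unfolding \<epsilon>_def using \<tau> by (intro mult_right_mono) auto
    also have "\<dots> < 1" using k3 by (simp add: k_def divide_less_eq)
    finally show "\<epsilon> < 1" .
  qed
  obtain D where D: "D \<ge> 0"
    "\<And>n. n > 0 \<Longrightarrow> (\<Sum>m=1..n. real (gcd n m) * real m powr (- \<epsilon>)) \<le> D * real n"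
    using sum_gcd_powr_le[OF \<epsilon>] by blast
  have "(\<Sum>m=1..n. overlap_error \<tau> f n m) \<le> (4 ^ k * (2 + D)) * lam (f n)"
    if n: "n > 0" for n
  proof -
    have "(\<Sum>m=1..n. overlap_error \<tau> f n m) \<le> (\<Sum>m=1..n. lam (f n) / real n ^ k *
        (4 ^ k * (real (gcd n m) ^ k + real n ^ (k - 1) * (real (gcd n m) * real m powr (- \<epsilon>)))))"
      unfolding \<epsilon>_def k_def using n lam \<tau> by (intro sum_mono overlap_error_le) auto
    also have "\<dots> = lam (f n) / real n ^ k * (4 ^ k * ((\<Sum>m=1..n. real (gcd n m) ^ k)
        + real n ^ (k - 1) * (\<Sum>m=1..n. real (gcd n m) * real m powr (- \<epsilon>))))"
      by (simp only: sum_distrib_left[symmetric] sum.distrib)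
    also have "\<dots> \<le> lam (f n) / real n ^ k *
        (4 ^ k * (2 * real n ^ k + real n ^ (k - 1) * (D * real n)))"
      using n k3 lam D(2)[OF n]
      by (intro mult_left_mono add_mono sum_gcd_power_le) (auto simp: k_def)
    also have "real n ^ (k - 1) * (D * real n) = D * real n ^ k"
      using k3 by (simp add: k_def power_eq_if[of _ "CARD('k)"])
    also have "lam (f n) / real n ^ k * (4 ^ k * (2 * real n ^ k + D * real n ^ k))
        = (4 ^ k * (2 + D)) * lam (f n)"
      using n by (simp add: field_simps)
    finally show ?thesis .
  qed
  then show ?thesis using that[of "4 ^ k * (2 + D)"] D by auto
qed

text \<open>Enlarging the square adds one row and one column, equal by symmetry up to the diagonal
  entry, which is nonnegative and may be counted twice.\<close>

lemma sum_square_le_twice_sum_triangle: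
  fixes E :: "nat \<Rightarrow> nat \<Rightarrow> real"
  assumes sym: "\<And>n m. E n m = E m n" and nonneg: "\<And>n m. n > 0 \<Longrightarrow> m > 0 \<Longrightarrow> E n m \<ge> 0"
  shows "(\<Sum>n=1..N. \<Sum>m=1..N. E n m) \<le> 2 * (\<Sum>n=1..N. \<Sum>m=1..n. E n m)"
proof (induction N)
  case (Suc N)
  have "(\<Sum>n=1..Suc N. \<Sum>m=1..Suc N. E n m)
      = (\<Sum>n=1..N. \<Sum>m=1..N. E n m) + (\<Sum>n=1..N. E n (Suc N)) + (\<Sum>m=1..Suc N. E (Suc N) m)"
    by (simp add: sum.distrib)
  also have "(\<Sum>n=1..N. E n (Suc N)) = (\<Sum>m=1..N. E (Suc N) m)"
    by (rule sum.cong[OF refl sym])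
  also have "\<dots> \<le> (\<Sum>m=1..Suc N. E (Suc N) m)"
    using nonneg[of "Suc N" "Suc N"] by simp
  finally show ?case using Suc by simp
qed simp

section \<open>Nonnegativity of the integrals and final assembly\<close>

lemma lam_nonneg_of_associated_function_system:
  assumes "associated_function_system \<omega>1 \<omega>2 y I d ty f" and "n > 0"
  shows "lam (f n) \<ge> 0"
proof -
  have \<omega>: "0 \<le> \<omega>1 x" "0 \<le> \<omega>2 x" for x
    using assms(1) by (auto simp: associated_function_system_def bump_on_def)
  have bump: "0 \<le> type_bump \<omega>1 \<omega>2 t x" for t x
    by (cases t) (auto simp: \<omega>)
  \<comment> \<open>The dyadic block of level \<open>m\<close> starts at \<open>2 ^ (m - 1)\<close>,
    so \<open>n\<close> has level \<open>p + 1\<close>.\<close>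
  obtain p where "2 ^ p \<le> n" "n < 2 ^ (p + 1)"
    using ex_power_ivl1[of 2 n] assms(2) by auto
  then have "n \<in> dyadic (p + 1)" by (simp add: dyadic_def)
  moreover have "\<forall>m\<ge>1. \<forall>n\<in>dyadic m. \<forall>x.
      f n x = (\<Sum>i\<in>I m. \<Sum>\<^sub>\<infinity>a\<in>UNIV. \<Prod>j\<in>UNIV.
        type_bump \<omega>1 \<omega>2 (ty m i j) ((x $ j - (of_int (a $ j) + y $ j) / real n) / d m i j))"
    using assms(1) unfolding associated_function_system_def by (elim conjE)
  ultimately have eq: "f n x = (\<Sum>i\<in>I (p + 1). \<Sum>\<^sub>\<infinity>a\<in>UNIV. \<Prod>j\<in>UNIV.
      type_bump \<omega>1 \<omega>2 (ty (p + 1) i j)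
        ((x $ j - (of_int (a $ j) + y $ j) / real n) / d (p + 1) i j))" for x
    using le_add2[of 1 p] by blast
  \<comment> \<open>Infinite sums and integrals default to \<open>0\<close>, so nonnegativity passes
    through both without a convergence argument.\<close>
  have "f n x \<ge> 0" for x
    unfolding eq by (intro sum_nonneg infsum_nonneg prod_nonneg bump)
  then show ?thesis
    unfolding lam_def set_lebesgue_integral_def
    by (intro Bochner_Integration.integral_nonneg) auto
qed

theorem mainTheorem15:
  fixes \<psi> :: "nat \<Rightarrow> real"
    and \<tau> C :: real
    and y :: "real ^ 'k"
    and I :: "nat \<Rightarrow> 'i set"
    and d :: "nat \<Rightarrow> 'i \<Rightarrow> 'k \<Rightarrow> real"
    and ty :: "nat \<Rightarrow> 'i \<Rightarrow> 'k \<Rightarrow> itype"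
    and A :: "nat \<Rightarrow> (real ^ 'k) set"
    and \<omega>1 \<omega>2 :: "real \<Rightarrow> real"
    and f :: "nat \<Rightarrow> real ^ 'k \<Rightarrow> real"
  assumes "CARD('k) \<ge> 3"
    and "\<forall>n\<ge>1. 0 \<le> \<psi> n \<and> \<psi> n < 1"
    and "admissible_set_system \<tau> y I d ty A"
    and "associated_function_system \<omega>1 \<omega>2 y I d ty f"
    and "C > 0"
    and "overlap_estimate \<tau> f C"
  shows "\<exists>K. \<forall>(\<gamma> :: nat \<Rightarrow> nat \<Rightarrow> real ^ 'k) N.
           (\<Sum>n=1..N. \<Sum>n'=1..N. overlap f n n' (\<gamma> n n'))
             \<le> C * (\<Sum>n=1..N. lam (f n))\<^sup>2 + K * (\<Sum>n=1..N. lam (f n))"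
proof -
  let ?E = "overlap_error \<tau> f"
  have lam: "lam (f n) \<ge> 0" if "n > 0" for n
    by (rule lam_nonneg_of_associated_function_system[OF assms(4) that])
  have E0: "?E n m \<ge> 0" if "n > 0" "m > 0" for n m
    using that by (intro overlap_error_nonneg lam)
  have \<tau>: "0 < \<tau>" "\<tau> < 1 / real CARD('k)"
    using admissible_set_system.tau[OF assms(3)] by auto
  obtain D where D: "D \<ge> 0"
    "\<And>n. n > 0 \<Longrightarrow> (\<Sum>m=1..n. ?E n m) \<le> D * lam (f n)"
    using sum_overlap_error_le[where f = f, OF assms(1) \<tau> lam] by blast
  \<comment> \<open>This \<open>K\<close> is uniform in the translation, so the final constant does
    not depend on the shifts.\<close>
  obtain K where K: "\<And>n m \<gamma>. n \<ge> 1 \<Longrightarrow> m \<ge> 1 \<Longrightarrow>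
      overlap f n m \<gamma> \<le> C * lam (f n) * lam (f m) + K * ?E n m"
    using assms(6) unfolding overlap_estimate_def by blast
  have "(\<Sum>n=1..N. \<Sum>m=1..N. overlap f n m (\<gamma> n m))
      \<le> C * (\<Sum>n=1..N. lam (f n))\<^sup>2 + (2 * \<bar>K\<bar> * D) * (\<Sum>n=1..N. lam (f n))"
    for \<gamma> :: "nat \<Rightarrow> nat \<Rightarrow> real ^ 'k" and N
  proof -
    \<comment> \<open>The sign of \<open>K\<close> is unknown; passing to
      \<open>\<bar>K\<bar>\<close> lets upper bounds for the nonnegative errors be inserted.\<close>
    have *: "overlap f n m (\<gamma> n m) \<le> C * lam (f n) * lam (f m) + \<bar>K\<bar> * ?E n m"
      if "n \<in> {1..N}" "m \<in> {1..N}" for n m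
      using that E0[of n m] mult_right_mono[OF abs_ge_self[of K], of "?E n m"] K[of n m "\<gamma> n m"]
      by auto
    have "(\<Sum>n=1..N. \<Sum>m=1..N. overlap f n m (\<gamma> n m))
        \<le> (\<Sum>n=1..N. \<Sum>m=1..N. C * lam (f n) * lam (f m) + \<bar>K\<bar> * ?E n m)"
      by (intro sum_mono *)
    also have "\<dots> = C * (\<Sum>n=1..N. lam (f n))\<^sup>2 + \<bar>K\<bar> * (\<Sum>n=1..N. \<Sum>m=1..N. ?E n m)"
      by (simp only: sum.distrib sum_product power2_eq_square sum_distrib_left[symmetric] mult.assoc)
    \<comment> \<open>Symmetry of the error reduces to pairs with \<open>m \<le> n\<close>, each
      charged to \<open>lam (f n)\<close>; this is the source of the factor 2.\<close>
    also have "\<dots> \<le> C * (\<Sum>n=1..N. lam (f n))\<^sup>2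
        + \<bar>K\<bar> * (2 * (\<Sum>n=1..N. \<Sum>m=1..n. ?E n m))"
      by (intro add_left_mono mult_left_mono sum_square_le_twice_sum_triangle
          overlap_error_commute E0) auto
    also have "\<dots> \<le> C * (\<Sum>n=1..N. lam (f n))\<^sup>2
        + \<bar>K\<bar> * (2 * (\<Sum>n=1..N. D * lam (f n)))"
      using D(2) by (intro add_left_mono mult_left_mono sum_mono) auto
    also have "(\<Sum>n=1..N. D * lam (f n)) = D * (\<Sum>n=1..N. lam (f n))"
      by (rule sum_distrib_left[symmetric])
    finally show ?thesis by (simp only: mult_ac)
  qed
  then show ?thesis by blast
qed

end
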